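(* Rooted divergence-preserving branching bisimilarity $\mathrel{\underline{\leftrightarrow}^{\Delta}_{rb}}$ is a congruence with respect to the operators of $\mathrm{TCP}^{\bullet}$: for all closed $\mathrm{TCP}^{\bullet}$ process expressions $P,Q,P_1,P_2,Q_1,Q_2$, every $a\in\mathcal{A}_\tau$ and every $\mathcal{C}'\subseteq\mathcal{C}$, if $P\mathrel{\underline{\leftrightarrow}^{\Delta}_{rb}}Q$, $P_1\mathrel{\underline{\leftrightarrow}^{\Delta}_{rb}}Q_1$ and $P_2\mathrel{\underline{\leftrightarrow}^{\Delta}_{rb}}Q_2$, then $a.P\mathrel{\underline{\leftrightarrow}^{\Delta}_{rb}}a.Q$, $P_1+P_2\mathrel{\underline{\leftrightarrow}^{\Delta}_{rb}}Q_1+Q_2$, $P_1\bullet P_2\mathrel{\underline{\leftrightarrow}^{\Delta}_{rb}}Q_1\bullet Q_2$, and $[P_1\parallel P_2]_{\mathcal{C}'}\mathrel{\underline{\leftrightarrow}^{\Delta}_{rb}}[Q_1\parallel Q_2]_{\mathcal{C}'}$.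
   Context: Let $\mathcal{A}$ be a set of action symbols, $\tau\notin\mathcal{A}$ a silent action, $\mathcal{A}_\tau=\mathcal{A}\cup\{\tau\}$. Let $\mathcal{C}$ be a set of channels and $\mathcal{D}_\Box$ a set of data; for $\mathcal{C}'\subseteq\mathcal{C}$ let $\mathcal{I}_{\mathcal{C}'}=\{c?d,\,c!d\mid d\in\mathcal{D}_\Box,\,c\in\mathcal{C}'\}\subseteq\mathcal{A}_\tau$. Let $\mathcal{N}$ be a countably infinite set of names. $\mathrm{TCP}^{\bullet}$ process expressions are given by $P::=\mathbf{0}\mid\mathbf{1}\mid a.P\mid P_1\bullet P_2\mid[P_1\parallel P_2]_{\mathcal{C}'}\mid P_1+P_2\mid N$ ($a\in\mathcal{A}_\tau$, $N\in\mathcal{N}$, $\mathcal{C}'\subseteq\mathcal{C}$), relative to a fixed recursive specification $E$ (a set of equations $N\overset{\mathrm{def}}{=}P$, at most one per name, with a defining equation for every name occurring in a right-hand side). Transitions $P\xrightarrow{a}P'$ and termination $P\downarrow$ are defined by the rules: $\mathbf{1}\downarrow$; $a.P\xrightarrow{a}P$; if $P_1\xrightarrow{a}P_1'$ then $P_1+P_2\xrightarrow{a}P_1'$, symmetrically for $P_2$; if $P_1\downarrow$ or $P_2\downarrow$ then $P_1+P_2\downarrow$; if $P_1\xrightarrow{a}P_1'$ and $a\notin\mathcal{I}_{\mathcal{C}'}$ then $[P_1\parallel P_2]_{\mathcal{C}'}\xrightarrow{a}[P_1'\parallel P_2]_{\mathcal{C}'}$, symmetrically for $P_2$; if $P_1\xrightarrow{c?d}P_1'$,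 $P_2\xrightarrow{c!d}P_2'$ (or $P_1\xrightarrow{c!d}P_1'$, $P_2\xrightarrow{c?d}P_2'$) with $c\in\mathcal{C}'$ then $[P_1\parallel P_2]_{\mathcal{C}'}\xrightarrow{\tau}[P_1'\parallel P_2']_{\mathcal{C}'}$; if $P_1\downarrow$ and $P_2\downarrow$ then $[P_1\parallel P_2]_{\mathcal{C}'}\downarrow$; if $P_1\downarrow$ and $P_2\downarrow$ then $P_1\bullet P_2\downarrow$; if $P_1\xrightarrow{a}P_1'$ then $P_1\bullet P_2\xrightarrow{a}P_1'\bullet P_2$; if $P_1\downarrow$, $P_2\xrightarrow{a}P_2'$ and $P_1$ has no outgoing transition at all, then $P_1\bullet P_2\xrightarrow{a}P_2'$; if $(N\overset{\mathrm{def}}{=}P)\in E$ and $P\xrightarrow{a}P'$ then $N\xrightarrow{a}P'$; if $(N\overset{\mathrm{def}}{=}P)\in E$ and $P\downarrow$ then $N\downarrow$. Write $\xrightarrow{}^{*}$ (resp. $\xrightarrow{}^{+}$) for the reflexive-transitive (resp. transitive) closure of $\xrightarrow{\tau}$, and $s\xrightarrow{(a)}t$ for "$s\xrightarrow{a}t$ or ($a=\tau$ and $s=t$)". A symmetric relation $R$ on states is a branching bisimulation if $s\,R\,t$ implies: (1) if $s\xrightarrow{a}s'$ then there are $t'',t'$ with $t\xrightarrow{}^{*}t''\xrightarrow{(a)}t'$, $s\,R\,t''$ and $s'\,R\,t'$; (2) if $s\downarrow$ then $t\xrightarrow{}^{*}t'$ for some $t'$ with $t'\downarrow$. It is divergence-preserving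 if moreover $s\,R\,t$ implies: (3) if there is an infinite sequence $s=s_0\xrightarrow{\tau}s_1\xrightarrow{\tau}\cdots$ with $s_i\,R\,t$ for all $i$, then there is $t'$ with $t\xrightarrow{}^{+}t'$ and $s_i\,R\,t'$ for some $i$. $s_1\mathrel{\underline{\leftrightarrow}^{\Delta}_{rb}}s_2$ (rooted divergence-preserving branching bisimilarity) holds if there is a divergence-preserving branching bisimulation $R$ with $s_1\,R\,s_2$ such that: if $s_1\xrightarrow{a}s_1'$ then $s_2\xrightarrow{a}s_2'$ for some $s_2'$ with $s_1'\,R\,s_2'$; and if $s_2\downarrow$ then $s_1\downarrow$.
   Formalization: The root clauses are required in both directions (s1 to s2 and s2 to s1); with one direction only, a.1 and a.1+τ.a.1 would be related but adding b.1 breaks it. Transitions are any stable model of the rules; E with none (e.g. N = N•a.1+1) defines no transition relation. *)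

theory Defs
  imports Main "HOL-Library.Countable" "HOL-Library.Infinite_Typeclass"
begin

(* The elements of A_tau. Recv c d is c?d, Send c d is c!d, and Act l stands for the
   action symbols that are not communications. *)
datatype ('l, 'c, 'd) action =
    Tau
  | Act 'l
  | Recv 'c 'd
  | Send 'c 'd

definition comm_actions :: "'c set \<Rightarrow> ('l, 'c, 'd) action set" where
  "comm_actions C = {Recv c d | c d. c \<in> C} \<union> {Send c d | c d. c \<in> C}"

(* Par C P Q is [P || Q]_C; Seq P Q is the sequencing P \<bullet> Q. *)
datatype ('l, 'c, 'd, proc_names: 'n) proc =
    Deadlock
  | Skip
  | Prefix "('l, 'c, 'd) action" "('l, 'c, 'd, 'n) proc"
  | Seq "('l, 'c, 'd, 'n) proc" "('l, 'c, 'd, 'n) proc"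
  | Par "'c set" "('l, 'c, 'd, 'n) proc" "('l, 'c, 'd, 'n) proc"
  | Alt "('l, 'c, 'd, 'n) proc" "('l, 'c, 'd, 'n) proc"
  | Name 'n

type_synonym ('l, 'c, 'd, 'n) spec = "'n \<rightharpoonup> ('l, 'c, 'd, 'n) proc"

definition recursive_spec :: "('l, 'c, 'd, 'n) spec \<Rightarrow> bool" where
  "recursive_spec E \<longleftrightarrow> (\<forall>N P. E N = Some P \<longrightarrow> proc_names P \<subseteq> dom E)"

inductive terminates :: "('l, 'c, 'd, 'n) spec \<Rightarrow> ('l, 'c, 'd, 'n) proc \<Rightarrow> bool"
  for E where
  skip: "terminates E Skip"
| alt1: "terminates E P1 \<Longrightarrow> terminates E (Alt P1 P2)"
| alt2: "terminates E P2 \<Longrightarrow> terminates E (Alt P1 P2)"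
| par: "terminates E P1 \<Longrightarrow> terminates E P2 \<Longrightarrow> terminates E (Par C P1 P2)"
| seq: "terminates E P1 \<Longrightarrow> terminates E P2 \<Longrightarrow> terminates E (Seq P1 P2)"
| name: "E N = Some P \<Longrightarrow> terminates E P \<Longrightarrow> terminates E (Name N)"

(* The rule seq2 has the negative premise "P1 has no outgoing transition", so the rules are not
   an inductive definition of the transition relation. As usual for transition system
   specifications with negative premises, derivability is defined relative to a relation T in
   which the negative premises are evaluated, and the transition relations determined by the rules
   are those T that agree with derivability (stable models). *)
inductive derivable ::
  "('l, 'c, 'd, 'n) spec
   \<Rightarrow> (('l, 'c, 'd, 'n) proc \<Rightarrow> ('l, 'c, 'd) action \<Rightarrow> ('l, 'c, 'd, 'n) proc \<Rightarrow> bool)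
   \<Rightarrow> ('l, 'c, 'd, 'n) proc \<Rightarrow> ('l, 'c, 'd) action \<Rightarrow> ('l, 'c, 'd, 'n) proc \<Rightarrow> bool"
  for E T where
  prefix: "derivable E T (Prefix a P) a P"
| alt1: "derivable E T P1 a P1' \<Longrightarrow> derivable E T (Alt P1 P2) a P1'"
| alt2: "derivable E T P2 a P2' \<Longrightarrow> derivable E T (Alt P1 P2) a P2'"
| par1: "derivable E T P1 a P1' \<Longrightarrow> a \<notin> comm_actions C
    \<Longrightarrow> derivable E T (Par C P1 P2) a (Par C P1' P2)"
| par2: "derivable E T P2 a P2' \<Longrightarrow> a \<notin> comm_actions C
    \<Longrightarrow> derivable E T (Par C P1 P2) a (Par C P1 P2')"
| comm1: "derivable E T P1 (Recv c d) P1' \<Longrightarrow> derivable E T P2 (Send c d) P2' \<Longrightarrow> c \<in> C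
    \<Longrightarrow> derivable E T (Par C P1 P2) Tau (Par C P1' P2')"
| comm2: "derivable E T P1 (Send c d) P1' \<Longrightarrow> derivable E T P2 (Recv c d) P2' \<Longrightarrow> c \<in> C
    \<Longrightarrow> derivable E T (Par C P1 P2) Tau (Par C P1' P2')"
| seq1: "derivable E T P1 a P1' \<Longrightarrow> derivable E T (Seq P1 P2) a (Seq P1' P2)"
| seq2: "terminates E P1 \<Longrightarrow> derivable E T P2 a P2' \<Longrightarrow> \<nexists>b P1'. T P1 b P1'
    \<Longrightarrow> derivable E T (Seq P1 P2) a P2'"
| name: "E N = Some P \<Longrightarrow> derivable E T P a P' \<Longrightarrow> derivable E T (Name N) a P'"

definition transition_relation ::
  "('l, 'c, 'd, 'n) spec
   \<Rightarrow> (('l, 'c, 'd, 'n) proc \<Rightarrow> ('l, 'c, 'd) action \<Rightarrow> ('l, 'c, 'd, 'n) proc \<Rightarrow> bool)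
   \<Rightarrow> bool" where
  "transition_relation E T \<longleftrightarrow> T = derivable E T"

definition branching_bisimulation ::
  "('s \<Rightarrow> ('l, 'c, 'd) action \<Rightarrow> 's \<Rightarrow> bool) \<Rightarrow> ('s \<Rightarrow> bool) \<Rightarrow> ('s \<Rightarrow> 's \<Rightarrow> bool) \<Rightarrow> bool" where
  "branching_bisimulation T trm R \<longleftrightarrow>
     symp R \<and>
     (\<forall>s t. R s t \<longrightarrow>
        (\<forall>a s'. T s a s' \<longrightarrow>
           (\<exists>t'' t'. (\<lambda>p q. T p Tau q)\<^sup>*\<^sup>* t t'' \<and> (T t'' a t' \<or> a = Tau \<and> t'' = t') \<and>
                     R s t'' \<and> R s' t')) \<and>
        (trm s \<longrightarrow> (\<exists>t'. (\<lambda>p q. T p Tau q)\<^sup>*\<^sup>* t t' \<and> trm t')))"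

definition divergence_preserving ::
  "('s \<Rightarrow> ('l, 'c, 'd) action \<Rightarrow> 's \<Rightarrow> bool) \<Rightarrow> ('s \<Rightarrow> 's \<Rightarrow> bool) \<Rightarrow> bool" where
  "divergence_preserving T R \<longleftrightarrow>
     (\<forall>s t. R s t \<longrightarrow>
        (\<forall>\<sigma> :: nat \<Rightarrow> 's. \<sigma> 0 = s \<and> (\<forall>i. T (\<sigma> i) Tau (\<sigma> (Suc i))) \<and> (\<forall>i. R (\<sigma> i) t) \<longrightarrow>
           (\<exists>t' i. (\<lambda>p q. T p Tau q)\<^sup>+\<^sup>+ t t' \<and> R (\<sigma> i) t')))"

definition root_condition ::
  "('s \<Rightarrow> ('l, 'c, 'd) action \<Rightarrow> 's \<Rightarrow> bool) \<Rightarrow> ('s \<Rightarrow> bool) \<Rightarrow> ('s \<Rightarrow> 's \<Rightarrow> bool)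
   \<Rightarrow> 's \<Rightarrow> 's \<Rightarrow> bool" where
  "root_condition T trm R s1 s2 \<longleftrightarrow>
     (\<forall>a s1'. T s1 a s1' \<longrightarrow> (\<exists>s2'. T s2 a s2' \<and> R s1' s2')) \<and>
     (trm s2 \<longrightarrow> trm s1)"

(* The root condition is imposed in both directions. With only one direction the relation would
   not be symmetric, and it would not be compatible with choice: it would relate a.1 to
   a.1 + tau.a.1, although a.1 + b.1 and a.1 + tau.a.1 + b.1 are not branching bisimilar. *)
definition rooted_dp_branching_bisimilar ::
  "('s \<Rightarrow> ('l, 'c, 'd) action \<Rightarrow> 's \<Rightarrow> bool) \<Rightarrow> ('s \<Rightarrow> bool) \<Rightarrow> 's \<Rightarrow> 's \<Rightarrow> bool" where
  "rooted_dp_branching_bisimilar T trm s1 s2 \<longleftrightarrow>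
     (\<exists>R. branching_bisimulation T trm R \<and> divergence_preserving T R \<and> R s1 s2 \<and>
          root_condition T trm R s1 s2 \<and> root_condition T trm R s2 s1)"


text \<open>
  For guarded specifications the rules have exactly one stable model. Some unguarded ones have none,
  for example the one consisting of the equation for \<open>N\<close> with right-hand side
  \<open>Alt (Seq (Name N) (Prefix a Skip)) Skip\<close>.
\<close>

primrec guarded :: "('l, 'c, 'd, 'n) proc \<Rightarrow> bool" where
  "guarded Deadlock \<longleftrightarrow> True"
| "guarded Skip \<longleftrightarrow> True"
| "guarded (Prefix a P) \<longleftrightarrow> True"
| "guarded (Seq P Q) \<longleftrightarrow> guarded P \<and> guarded Q"
| "guarded (Par C P Q) \<longleftrightarrow> guarded P \<and> guarded Q"
| "guarded (Alt P Q) \<longleftrightarrow> guarded P \<and> guarded Q"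
| "guarded (Name N) \<longleftrightarrow> False"

primrec outs ::
  "('l, 'c, 'd, 'n) spec \<Rightarrow> ('n \<Rightarrow> ('l, 'c, 'd) action \<Rightarrow> ('l, 'c, 'd, 'n) proc \<Rightarrow> bool)
   \<Rightarrow> ('l, 'c, 'd, 'n) proc \<Rightarrow> ('l, 'c, 'd) action \<Rightarrow> ('l, 'c, 'd, 'n) proc \<Rightarrow> bool" where
  "outs E I Deadlock = (\<lambda>a X. False)"
| "outs E I Skip = (\<lambda>a X. False)"
| "outs E I (Prefix b P) = (\<lambda>a X. a = b \<and> X = P)"
| "outs E I (Seq P Q) = (\<lambda>a X. (\<exists>P'. outs E I P a P' \<and> X = Seq P' Q) \<or>
     terminates E P \<and> outs E I Q a X \<and> (\<nexists>b P'. outs E I P b P'))"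
| "outs E I (Par C P Q) = (\<lambda>a X.
     a \<notin> comm_actions C \<and> (\<exists>P'. outs E I P a P' \<and> X = Par C P' Q) \<or>
     a \<notin> comm_actions C \<and> (\<exists>Q'. outs E I Q a Q' \<and> X = Par C P Q') \<or>
     a = Tau \<and> (\<exists>c d P' Q'. c \<in> C \<and> X = Par C P' Q' \<and>
       (outs E I P (Recv c d) P' \<and> outs E I Q (Send c d) Q' \<or>
        outs E I P (Send c d) P' \<and> outs E I Q (Recv c d) Q')))"
| "outs E I (Alt P Q) = (\<lambda>a X. outs E I P a X \<or> outs E I Q a X)"
| "outs E I (Name N) = I N"

lemma outs_guarded: "guarded P \<Longrightarrow> outs E I P = outs E J P"
  by (induction P) simp_all

lemma derivable_outs:
  assumes "\<And>N. I N = (\<lambda>a X. \<exists>P. E N = Some P \<and> outs E I P a X)"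
    and "derivable E (outs E I) P a X"
  shows "outs E I P a X"
  using assms(2)
proof (induction rule: derivable.induct)
  case (name N P a P')
  then show ?case by (auto simp: assms(1)[of N])
qed auto

lemma outs_derivable:
  assumes "guarded P \<or> (\<forall>N a X. I N a X \<longrightarrow> derivable E (outs E I) (Name N) a X)"
    and "outs E I P a X"
  shows "derivable E (outs E I) P a X"
  using assms
proof (induction P arbitrary: a X)
  case (Prefix b P)
  then show ?case by (auto intro: derivable.intros)
next
  case (Seq P Q)
  then show ?case by (auto intro: derivable.seq1 derivable.seq2)
next
  case (Par C P Q)
  then show ?case
    by (auto intro: derivable.par1 derivable.par2)
      (blast intro: derivable.comm1 derivable.comm2)+
next
  case (Alt P Q)
  then show ?case by (auto intro: derivable.alt1 derivable.alt2)
qed auto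

lemma transition_relation_outs:
  assumes "transition_relation E T"
  shows "T P = outs E (\<lambda>N. T (Name N)) P"
proof -
  have T: "T P a X \<longleftrightarrow> derivable E T P a X" for P a X
    using assms unfolding transition_relation_def by metis
  show ?thesis
  proof (induction P)
    case Deadlock
    then show ?case by (auto simp: fun_eq_iff T elim: derivable.cases)
  next
    case Skip
    then show ?case by (auto simp: fun_eq_iff T elim: derivable.cases)
  next
    case (Prefix b P)
    then show ?case
      by (auto simp: fun_eq_iff T intro: derivable.intros elim: derivable.cases)
  next
    case (Seq P Q)
    have "T (Seq P Q) a X \<longleftrightarrow> (\<exists>P'. T P a P' \<and> X = Seq P' Q) \<or>
        terminates E P \<and> T Q a X \<and> (\<nexists>b P'. T P b P')" for a X
      unfolding T[of "Seq P Q"] by (subst derivable.simps) (auto simp flip: T)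
    then show ?case by (simp add: fun_eq_iff flip: Seq.IH)
  next
    case (Par C P Q)
    have "T (Par C P Q) a X \<longleftrightarrow>
        a \<notin> comm_actions C \<and> (\<exists>P'. T P a P' \<and> X = Par C P' Q) \<or>
        a \<notin> comm_actions C \<and> (\<exists>Q'. T Q a Q' \<and> X = Par C P Q') \<or>
        a = Tau \<and> (\<exists>c d P' Q'. c \<in> C \<and> X = Par C P' Q' \<and>
          (T P (Recv c d) P' \<and> T Q (Send c d) Q' \<or> T P (Send c d) P' \<and> T Q (Recv c d) Q'))"
      for a X
      unfolding T[of "Par C P Q"] by (subst derivable.simps) (simp flip: T, blast)
    then show ?case by (simp add: fun_eq_iff flip: Par.IH)
  next
    case (Alt P Q)
    have "T (Alt P Q) a X \<longleftrightarrow> T P a X \<or> T Q a X" for a X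
      unfolding T[of "Alt P Q"] by (subst derivable.simps) (auto simp flip: T)
    then show ?case by (simp add: fun_eq_iff flip: Alt.IH)
  next
    case (Name N)
    then show ?case by simp
  qed
qed

lemma guarded_ex1_transition_relation:
  assumes "\<And>N P. E N = Some P \<Longrightarrow> guarded P"
  shows "\<exists>!T. transition_relation E T"
proof -
  define I where "I = (\<lambda>N a X. \<exists>P. E N = Some P \<and> outs E (\<lambda>_ _ _. False) P a X)"
  have I: "I N = (\<lambda>a X. \<exists>P. E N = Some P \<and> outs E J P a X)" for N J
    unfolding I_def using outs_guarded[OF assms] by metis
  show ?thesis
  proof
    have "derivable E (outs E I) (Name N) a X" if IN: "I N a X" for N a X
    proof -
      obtain P where P: "E N = Some P" "outs E I P a X"
        using IN by (auto simp: I[of N I])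
      have "derivable E (outs E I) P a X"
        using P assms by (intro outs_derivable) auto
      with P(1) show ?thesis by (rule derivable.name)
    qed
    then have "outs E I P a X \<longleftrightarrow> derivable E (outs E I) P a X" for P a X
      using derivable_outs[of I E P a X, OF I] outs_derivable[of P I E a X] by blast
    then show "transition_relation E (outs E I)"
      by (auto simp: transition_relation_def fun_eq_iff)
  next
    fix T assume T: "transition_relation E T"
    have *: "T P a X \<longleftrightarrow> derivable E T P a X" for P a X
      using T unfolding transition_relation_def by metis
    have "T (Name N) a X \<longleftrightarrow> (\<exists>P. E N = Some P \<and> T P a X)" for N a X
      unfolding *[of "Name N"] by (subst derivable.simps) (simp flip: *)
    then have "T (Name N) = I N" for N
      unfolding I[of N "\<lambda>N. T (Name N)"] transition_relation_outs[OF T, symmetric]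
      by (intro ext)
    then have eq: "(\<lambda>N. T (Name N)) = I" by simp
    show "T = outs E I"
      by (rule ext, rule transition_relation_outs[OF T, unfolded eq])
  qed
qed

end

theory Submission
  imports Defs "HOL-Library.Infinite_Set"
begin

text \<open>
  In the presence of the transfer condition, a symmetric relation \<open>R\<close> preserves divergence iff
  for \<open>R s t\<close> and an arbitrary infinite \<open>\<tau>\<close>-path from \<open>s\<close> (not only one that stays related
  to \<open>t\<close>), \<open>t\<close> can make at least one \<open>\<tau>\<close>-step to a state related to some state of the path: the first
  state of the path not related to \<open>t\<close> forces \<open>t\<close> to move. In this form the condition is visibly
  closed under unions, so a single \<open>R\<close> may be used for all arguments of an operator.
  For choice and prefix it suffices to add the pair of roots to \<open>R\<close>.
  For sequencing, relate \<open>p \<bullet> A\<close> to \<open>q \<bullet> B\<close> whenever \<open>R p q\<close> and \<open>A\<close>, \<open>B\<close> are root-related: if \<open>p\<close>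
  is terminating and stuck, then \<open>q\<close> can only do \<open>\<tau>\<close>-steps, cannot diverge, and hence reaches
  a terminating stuck state, from which \<open>B\<close> starts.
  For parallel composition, relate componentwise: an infinite \<open>\<tau>\<close>-path contains a
  communication or infinitely many \<open>\<tau>\<close>-steps of one component.
\<close>

section \<open>Divergence-preserving branching bisimulations\<close>

abbreviation tau_step :: "('s \<Rightarrow> ('l, 'c, 'd) action \<Rightarrow> 's \<Rightarrow> bool) \<Rightarrow> 's \<Rightarrow> 's \<Rightarrow> bool" where
  "tau_step T \<equiv> \<lambda>p q. T p Tau q"

definition dp_branching_bisimulation ::
  "('s \<Rightarrow> ('l, 'c, 'd) action \<Rightarrow> 's \<Rightarrow> bool) \<Rightarrow> ('s \<Rightarrow> bool) \<Rightarrow> ('s \<Rightarrow> 's \<Rightarrow> bool) \<Rightarrow> bool" where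
  "dp_branching_bisimulation T trm R \<longleftrightarrow>
     branching_bisimulation T trm R \<and> divergence_preserving T R"

text \<open>For a matching move that might be empty: the empty move ends in \<open>t\<close>, so any
  other end point forces at least one silent step.\<close>

lemma tau_stepsp_if_neq:
  assumes "(tau_step T)\<^sup>*\<^sup>* t t''" and "T t'' Tau t' \<or> t'' = t'" and "t' \<noteq> t"
  shows "(tau_step T)\<^sup>+\<^sup>+ t t'"
  using assms by (metis rtranclp_into_tranclp1 rtranclpD)

lemma dp_branching_bisimulationI:
  assumes "symp R"
    and "\<And>s t a s'. R s t \<Longrightarrow> T s a s' \<Longrightarrow>
      \<exists>t'' t'. (tau_step T)\<^sup>*\<^sup>* t t'' \<and> (T t'' a t' \<or> a = Tau \<and> t'' = t') \<and> R s t'' \<and> R s' t'"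
    and "\<And>s t. R s t \<Longrightarrow> trm s \<Longrightarrow> \<exists>t'. (tau_step T)\<^sup>*\<^sup>* t t' \<and> trm t'"
    and "\<And>\<sigma> t. (\<And>i. T (\<sigma> i) Tau (\<sigma> (Suc i))) \<Longrightarrow> (\<And>i. R (\<sigma> i) t) \<Longrightarrow>
      \<exists>t' i. (tau_step T)\<^sup>+\<^sup>+ t t' \<and> R (\<sigma> i) t'"
  shows "dp_branching_bisimulation T trm R"
  unfolding dp_branching_bisimulation_def branching_bisimulation_def divergence_preserving_def
  using assms by simp

lemma dp_branching_bisimulation_sym:
  "dp_branching_bisimulation T trm R \<Longrightarrow> R s t \<Longrightarrow> R t s"
  unfolding dp_branching_bisimulation_def branching_bisimulation_def by (blast dest: sympD)

lemma dp_branching_bisimulation_step: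
  assumes "dp_branching_bisimulation T trm R" and "R s t" and "T s a s'"
  obtains t'' t' where "(tau_step T)\<^sup>*\<^sup>* t t''" "T t'' a t' \<or> a = Tau \<and> t'' = t'" "R s t''" "R s' t'"
  using assms unfolding dp_branching_bisimulation_def branching_bisimulation_def by blast

lemma dp_branching_bisimulation_trm:
  assumes "dp_branching_bisimulation T trm R" and "R s t" and "trm s"
  obtains t' where "(tau_step T)\<^sup>*\<^sup>* t t'" "trm t'"
  using assms unfolding dp_branching_bisimulation_def branching_bisimulation_def by blast

text \<open>Only the start of the path has to be related to \<open>t\<close>. A path that stays
  related to \<open>t\<close> falls under the defining clause; any other path has a step that leaves
  the states related to \<open>t\<close>.\<close>

lemma dp_branching_bisimulation_divergence:
  assumes R: "dp_branching_bisimulation T trm R" and "R (\<sigma> 0) t"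
    and path: "\<And>i. T (\<sigma> i) Tau (\<sigma> (Suc i))"
  obtains t' i where "(tau_step T)\<^sup>+\<^sup>+ t t'" "R (\<sigma> i) t'"
proof (cases "\<forall>i. R (\<sigma> i) t")
  case True
  with R path \<open>R (\<sigma> 0) t\<close> have "\<exists>t' i. (tau_step T)\<^sup>+\<^sup>+ t t' \<and> R (\<sigma> i) t'"
    unfolding dp_branching_bisimulation_def divergence_preserving_def by blast
  with that show ?thesis by blast
next
  case False
  with \<open>R (\<sigma> 0) t\<close> obtain i where i: "R (\<sigma> i) t" "\<not> R (\<sigma> (Suc i)) t"
    using nat_induct[of "\<lambda>i. R (\<sigma> i) t"] by blast
  obtain t'' t' where t': "(tau_step T)\<^sup>*\<^sup>* t t''" "T t'' Tau t' \<or> t'' = t'" "R (\<sigma> (Suc i)) t'"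
    using dp_branching_bisimulation_step[OF R i(1) path] by metis
  \<comment> \<open>\<open>t'\<close> is related to \<open>\<sigma> (Suc i)\<close> while
    \<open>t\<close> is not, so the two differ and the matching move is nonempty.\<close>
  with i(2) have "(tau_step T)\<^sup>+\<^sup>+ t t'" by (metis tau_stepsp_if_neq)
  with t'(3) that show ?thesis by blast
qed

lemma dp_branching_bisimulation_steps:
  assumes "dp_branching_bisimulation T trm R" and "R s t" and "(tau_step T)\<^sup>*\<^sup>* s s'"
  obtains t' where "(tau_step T)\<^sup>*\<^sup>* t t'" "R s' t'"
proof -
  have "\<exists>t'. (tau_step T)\<^sup>*\<^sup>* t t' \<and> R s' t'"
    using assms(3)
  proof induction
    case base
    with assms(2) show ?case by blast
  next
    case (step u v)
    then obtain t1 where t1: "(tau_step T)\<^sup>*\<^sup>* t t1" "R u t1" by blast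
    obtain t2 t3 where "(tau_step T)\<^sup>*\<^sup>* t1 t2" "T t2 Tau t3 \<or> t2 = t3" "R v t3"
      using dp_branching_bisimulation_step[OF assms(1) t1(2) step.hyps(2)] by metis
    then show ?case
      using t1(1) by (metis rtranclp_trans rtranclp.rtrancl_into_rtrancl)
  qed
  with that show ?thesis by blast
qed

section \<open>Unions and added root pairs\<close>

text \<open>A diverging path may alternate between states related to \<open>t\<close> by
  \<open>R\<close> and by \<open>S\<close>. As \<open>dp_branching_bisimulation_divergence\<close>
  looks only at index 0, whichever relation holds there settles the case.\<close>

lemma dp_branching_bisimulation_sup:
  assumes R: "dp_branching_bisimulation T trm R" and S: "dp_branching_bisimulation T trm S"
  shows "dp_branching_bisimulation T trm (sup R S)"
proof (rule dp_branching_bisimulationI)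
  show "symp (sup R S)"
    using dp_branching_bisimulation_sym[OF R] dp_branching_bisimulation_sym[OF S]
    by (auto intro: sympI)
next
  fix s t a s' assume "sup R S s t" "T s a s'"
  then show "\<exists>t'' t'. (tau_step T)\<^sup>*\<^sup>* t t'' \<and> (T t'' a t' \<or> a = Tau \<and> t'' = t') \<and>
      sup R S s t'' \<and> sup R S s' t'"
    by (metis (full_types) sup2CI sup2E dp_branching_bisimulation_step[OF R]
        dp_branching_bisimulation_step[OF S])
next
  fix s t assume "sup R S s t" "trm s"
  then show "\<exists>t'. (tau_step T)\<^sup>*\<^sup>* t t' \<and> trm t'"
    by (metis sup2E dp_branching_bisimulation_trm[OF R] dp_branching_bisimulation_trm[OF S])
next
  fix \<sigma> t
  assume path: "\<And>i. T (\<sigma> i) Tau (\<sigma> (Suc i))" and rel: "\<And>i. sup R S (\<sigma> i) t"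
  from rel[of 0] show "\<exists>t' i. (tau_step T)\<^sup>+\<^sup>+ t t' \<and> sup R S (\<sigma> i) t'"
  proof (rule sup2E)
    assume "R (\<sigma> 0) t"
    from dp_branching_bisimulation_divergence[OF R this path] show ?thesis by blast
  next
    assume "S (\<sigma> 0) t"
    from dp_branching_bisimulation_divergence[OF S this path] show ?thesis by blast
  qed
qed

lemma root_condition_mono:
  "root_condition T trm R s t \<Longrightarrow> R \<le> S \<Longrightarrow> root_condition T trm S s t"
  unfolding root_condition_def by blast

text \<open>Each step from a root is answered by exactly one step, and the residuals lie in
  \<open>R\<close>. A divergence from a root is therefore answered already at its first
  step.\<close>

lemma dp_branching_bisimulation_add_root:
  assumes R: "dp_branching_bisimulation T trm R"
    and root: "root_condition T trm R s t" "root_condition T trm R t s"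
  shows "dp_branching_bisimulation T trm (\<lambda>x y. R x y \<or> (x, y) \<in> {(s, t), (t, s)})"
    (is "dp_branching_bisimulation T trm ?S")
proof -
  have step: "\<exists>y'. T y a y' \<and> R x' y'" if "(x, y) \<in> {(s, t), (t, s)}" "T x a x'" for x y a x'
    using that root unfolding root_condition_def by blast
  have trm: "trm y" if "(x, y) \<in> {(s, t), (t, s)}" "trm x" for x y
    using that root unfolding root_condition_def by blast
  show ?thesis
  proof (rule dp_branching_bisimulationI)
    show "symp ?S"
      using dp_branching_bisimulation_sym[OF R] by (auto intro!: sympI)
  next
    fix x y a x' assume xy: "?S x y" and x': "T x a x'"
    show "\<exists>y'' y'. (tau_step T)\<^sup>*\<^sup>* y y'' \<and> (T y'' a y' \<or> a = Tau \<and> y'' = y') \<and> ?S x y'' \<and> ?S x' y'"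
      using xy
    proof
      assume "R x y"
      from dp_branching_bisimulation_step[OF R this x'] show ?thesis by metis
    next
      assume new: "(x, y) \<in> {(s, t), (t, s)}"
      from step[OF this x'] new show ?thesis by blast
    qed
  next
    fix x y assume "?S x y" "trm x"
    then show "\<exists>y'. (tau_step T)\<^sup>*\<^sup>* y y' \<and> trm y'"
      by (metis rtranclp.rtrancl_refl trm dp_branching_bisimulation_trm[OF R])
  next
    fix \<sigma> y
    assume path: "\<And>i. T (\<sigma> i) Tau (\<sigma> (Suc i))" and rel: "\<And>i. ?S (\<sigma> i) y"
    from rel[of 0] show "\<exists>y' i. (tau_step T)\<^sup>+\<^sup>+ y y' \<and> ?S (\<sigma> i) y'"
    proof
      assume "R (\<sigma> 0) y"
      from dp_branching_bisimulation_divergence[OF R this path] show ?thesis by metis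
    next
      assume "(\<sigma> 0, y) \<in> {(s, t), (t, s)}"
      from step[OF this path[of 0]] show ?thesis by (metis tranclp.r_into_trancl)
    qed
  qed
qed

text \<open>Allows witnesses that do not relate the roots themselves: the root pair is added
  afterwards, and enlarging a relation preserves root conditions.\<close>

lemma rooted_dp_branching_bisimilarI:
  assumes "dp_branching_bisimulation T trm R"
    and "root_condition T trm R s t" and "root_condition T trm R t s"
  shows "rooted_dp_branching_bisimilar T trm s t"
proof -
  let ?S = "\<lambda>x y. R x y \<or> (x, y) \<in> {(s, t), (t, s)}"
  have "R \<le> ?S" by blast
  then show ?thesis
    using dp_branching_bisimulation_add_root[OF assms] assms(2,3)[THEN root_condition_mono, of ?S]
    unfolding rooted_dp_branching_bisimilar_def dp_branching_bisimulation_def by blast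
qed

lemma rooted_dp_branching_bisimilarE:
  assumes "rooted_dp_branching_bisimilar T trm s t"
  obtains R where "dp_branching_bisimulation T trm R" "R s t"
    "root_condition T trm R s t" "root_condition T trm R t s"
  using assms unfolding rooted_dp_branching_bisimilar_def dp_branching_bisimulation_def by blast

section \<open>Stuck states and stuttering paths\<close>

text \<open>The stuck state \<open>p\<close> can answer a silent path from \<open>q\<close> only by
  staying where it is.\<close>

lemma stuck_tau_steps_related:
  assumes R: "dp_branching_bisimulation T trm R" and "R p q" and "\<nexists>b p'. T p b p'"
    and "(tau_step T)\<^sup>*\<^sup>* q q'"
  shows "R p q'"
proof -
  obtain p' where "(tau_step T)\<^sup>*\<^sup>* p p'" "R q' p'"
    using dp_branching_bisimulation_steps[OF R] dp_branching_bisimulation_sym[OF R] assms(2,4)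
    by metis
  with assms(3) have "R q' p" by (metis converse_rtranclpE)
  then show ?thesis by (rule dp_branching_bisimulation_sym[OF R])
qed

text \<open>A divergence of \<open>q\<close> would force \<open>p\<close> to move, so silent steps
  from \<open>q\<close> can be followed to a state without any. That state is still related to
  \<open>p\<close>, which excludes visible steps as well, and it must answer the termination of
  \<open>p\<close> on the spot.\<close>

lemma stuck_terminating_match:
  assumes R: "dp_branching_bisimulation T trm R" and pq: "R p q"
    and stuck: "\<nexists>b p'. T p b p'" and "trm p"
  obtains q' where "(tau_step T)\<^sup>*\<^sup>* q q'" "R p q'" "trm q'" "\<nexists>b r. T q' b r"
proof -
  have "\<exists>q'. (tau_step T)\<^sup>*\<^sup>* q q' \<and> (\<nexists>r. T q' Tau r)"
  proof (rule ccontr)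
    assume contr: "\<not> ?thesis"
    \<comment> \<open>Dependent choice leaves the first state open; the clause at index 0 pins it to
      \<open>q\<close>.\<close>
    have "\<exists>\<sigma>. \<forall>i. ((tau_step T)\<^sup>*\<^sup>* q (\<sigma> i) \<and> (i = 0 \<longrightarrow> \<sigma> i = q)) \<and> T (\<sigma> i) Tau (\<sigma> (Suc i))"
    proof (rule dependent_nat_choice)
      fix x :: 'a and n :: nat
      assume x: "(tau_step T)\<^sup>*\<^sup>* q x \<and> (n = 0 \<longrightarrow> x = q)"
      with contr obtain r where r: "T x Tau r" by blast
      with x have "(tau_step T)\<^sup>*\<^sup>* q r" by (metis (mono_tags) rtranclp.rtrancl_into_rtrancl)
      with r show "\<exists>y. ((tau_step T)\<^sup>*\<^sup>* q y \<and> (Suc n = 0 \<longrightarrow> y = q)) \<and> T x Tau y" by auto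
    qed simp
    then obtain \<sigma> where \<sigma>: "\<sigma> 0 = q" "\<And>i. T (\<sigma> i) Tau (\<sigma> (Suc i))" by metis
    have "R (\<sigma> 0) p" using dp_branching_bisimulation_sym[OF R pq] \<sigma>(1) by simp
    from dp_branching_bisimulation_divergence[OF R this \<sigma>(2)]
    obtain p' where "(tau_step T)\<^sup>+\<^sup>+ p p'" by metis
    with stuck show False by (metis tranclpD)
  qed
  then obtain q' where q': "(tau_step T)\<^sup>*\<^sup>* q q'" "\<nexists>r. T q' Tau r" by blast
  have rel: "R p q'" by (rule stuck_tau_steps_related[OF R pq stuck q'(1)])
  \<comment> \<open>Since \<open>p\<close> cannot move, the match is empty and
    \<open>b = Tau\<close>, but \<open>q'\<close> has no silent step.\<close>
  have no_step: False if step: "T q' b r" for b r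
  proof -
    obtain p'' p' where "(tau_step T)\<^sup>*\<^sup>* p p''" "T p'' b p' \<or> b = Tau \<and> p'' = p'"
      using dp_branching_bisimulation_step[OF R dp_branching_bisimulation_sym[OF R rel] step]
      by metis
    with stuck q'(2) step show False by (metis converse_rtranclpE)
  qed
  obtain r where "(tau_step T)\<^sup>*\<^sup>* q' r" "trm r"
    using dp_branching_bisimulation_trm[OF R rel \<open>trm p\<close>] .
  with q'(2) have "trm q'" by (metis converse_rtranclpE)
  with q'(1) rel no_step that show ?thesis by blast
qed

text \<open>Intended for one component of a parallel composition, which rests while the other moves.
  Enumerating the indices of its moves in increasing order removes the rests and leaves a genuine
  infinite silent path.\<close>

lemma dp_branching_bisimulation_stuttering_divergence:
  assumes R: "dp_branching_bisimulation T trm R" and rel: "\<And>i. R (f i) t"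
    and stutter: "\<And>i. f (Suc i) = f i \<or> T (f i) Tau (f (Suc i))"
    and inf: "infinite {i. T (f i) Tau (f (Suc i))}"
  obtains t' i where "(tau_step T)\<^sup>+\<^sup>+ t t'" "R (f i) t'"
proof -
  let ?F = "{i. T (f i) Tau (f (Suc i))}"
  have const: "f (enumerate ?F (Suc n)) = f (Suc (enumerate ?F n))" for n
  proof -
    have less: "enumerate ?F n < enumerate ?F (Suc n)"
      using inf by (rule enumerate_step)
    have "f k = f (Suc (enumerate ?F n))" if "Suc (enumerate ?F n) \<le> k" "k \<le> enumerate ?F (Suc n)" for k
      using that
    proof (induction k rule: dec_induct)
      case (step k)
      \<comment> \<open>The next enumerated index is the least move index after the previous one, so
        \<open>k\<close>, lying strictly between them, is a rest.\<close>
      then have "k < (LEAST s. s \<in> ?F \<and> enumerate ?F n < s)"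
        using enumerate_Suc''[OF inf, of n] by simp
      then have "k \<notin> ?F"
        using not_less_Least[of k] step.hyps(1) by (metis (mono_tags, lifting) Suc_le_lessD)
      with stutter[of k] have "f (Suc k) = f k" by blast
      with step.IH step.prems show ?case by simp
    qed simp
    from this[OF Suc_leI[OF less] order_refl] show ?thesis .
  qed
  define \<sigma> where "\<sigma> n = f (enumerate ?F n)" for n
  have "T (\<sigma> n) Tau (\<sigma> (Suc n))" for n
    unfolding \<sigma>_def const using enumerate_in_set[OF inf, of n] by blast
  moreover have "R (\<sigma> 0) t" unfolding \<sigma>_def by (rule rel)
  ultimately obtain t' i where "(tau_step T)\<^sup>+\<^sup>+ t t'" "R (\<sigma> i) t'"
    using dp_branching_bisimulation_divergence[OF R, of \<sigma> t] by metis
  then show ?thesis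
    using that unfolding \<sigma>_def by blast
qed

section \<open>The operators\<close>

lemma Tau_notin_comm_actions [simp]: "Tau \<notin> comm_actions C"
  by (simp add: comm_actions_def)

lemma terminates_simps [simp]:
  "\<not> terminates E (Prefix a P)"
  "terminates E (Alt P Q) \<longleftrightarrow> terminates E P \<or> terminates E Q"
  "terminates E (Seq P Q) \<longleftrightarrow> terminates E P \<and> terminates E Q"
  "terminates E (Par C P Q) \<longleftrightarrow> terminates E P \<and> terminates E Q"
  by (subst terminates.simps, blast)+

context
  fixes E :: "('l, 'c, 'd, 'n) spec"
    and T :: "('l, 'c, 'd, 'n) proc \<Rightarrow> ('l, 'c, 'd) action \<Rightarrow> ('l, 'c, 'd, 'n) proc \<Rightarrow> bool"
  assumes T: "transition_relation E T"
begin

section \<open>Transitions and silent paths of composed processes\<close>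

text \<open>A stable model agrees with \<open>outs\<close> once names are interpreted by the model
  itself. Unfolding one operator thus yields its exact transitions, the negative premise of
  sequencing included.\<close>

lemma transition_Prefix: "T (Prefix b P) a X \<longleftrightarrow> a = b \<and> X = P"
  by (subst transition_relation_outs[OF T]) simp

lemma transition_Alt: "T (Alt P Q) a X \<longleftrightarrow> T P a X \<or> T Q a X"
  by (subst transition_relation_outs[OF T, of "Alt P Q"])
    (simp only: outs.simps, simp only: transition_relation_outs[OF T, symmetric])

lemma transition_Seq: "T (Seq P Q) a X \<longleftrightarrow>
    (\<exists>P'. T P a P' \<and> X = Seq P' Q) \<or> terminates E P \<and> T Q a X \<and> (\<nexists>b P'. T P b P')"
  by (subst transition_relation_outs[OF T, of "Seq P Q"])
    (simp only: outs.simps, simp only: transition_relation_outs[OF T, symmetric])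

lemma transition_Par: "T (Par C P Q) a X \<longleftrightarrow>
    a \<notin> comm_actions C \<and> (\<exists>P'. T P a P' \<and> X = Par C P' Q) \<or>
    a \<notin> comm_actions C \<and> (\<exists>Q'. T Q a Q' \<and> X = Par C P Q') \<or>
    a = Tau \<and> (\<exists>c d P' Q'. c \<in> C \<and> X = Par C P' Q' \<and>
      (T P (Recv c d) P' \<and> T Q (Send c d) Q' \<or> T P (Send c d) P' \<and> T Q (Recv c d) Q'))"
  by (subst transition_relation_outs[OF T, of "Par C P Q"])
    (simp only: outs.simps, simp only: transition_relation_outs[OF T, symmetric])

lemma tau_steps_Seq: "(tau_step T)\<^sup>*\<^sup>* p p' \<Longrightarrow> (tau_step T)\<^sup>*\<^sup>* (Seq p q) (Seq p' q)"
  by (induction rule: rtranclp_induct) (auto simp: transition_Seq intro: rtranclp.rtrancl_into_rtrancl)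

lemma tau_stepsp_Seq: "(tau_step T)\<^sup>+\<^sup>+ p p' \<Longrightarrow> (tau_step T)\<^sup>+\<^sup>+ (Seq p q) (Seq p' q)"
  by (induction rule: tranclp_induct) (auto simp: transition_Seq intro: tranclp.trancl_into_trancl)

text \<open>\<open>Tau\<close> is never restricted by \<open>C\<close>, so the components can run
  their silent paths one after the other.\<close>

lemma tau_steps_Par:
  assumes "(tau_step T)\<^sup>*\<^sup>* p p'" and "(tau_step T)\<^sup>*\<^sup>* q q'"
  shows "(tau_step T)\<^sup>*\<^sup>* (Par C p q) (Par C p' q')"
proof -
  from assms(1) have "(tau_step T)\<^sup>*\<^sup>* (Par C p q) (Par C p' q)"
    by (induction rule: rtranclp_induct)
      (auto simp: transition_Par intro: rtranclp.rtrancl_into_rtrancl)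
  also from assms(2) have "(tau_step T)\<^sup>*\<^sup>* (Par C p' q) (Par C p' q')"
    by (induction rule: rtranclp_induct)
      (auto simp: transition_Par intro: rtranclp.rtrancl_into_rtrancl)
  finally show ?thesis .
qed

lemma tau_stepsp_Par1: "(tau_step T)\<^sup>+\<^sup>+ p p' \<Longrightarrow> (tau_step T)\<^sup>+\<^sup>+ (Par C p q) (Par C p' q)"
  by (induction rule: tranclp_induct) (auto simp: transition_Par intro: tranclp.trancl_into_trancl)

lemma tau_stepsp_Par2: "(tau_step T)\<^sup>+\<^sup>+ q q' \<Longrightarrow> (tau_step T)\<^sup>+\<^sup>+ (Par C p q) (Par C p q')"
  by (induction rule: tranclp_induct) (auto simp: transition_Par intro: tranclp.trancl_into_trancl)

section \<open>Prefix and choice\<close>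

lemma rooted_Prefix:
  assumes "dp_branching_bisimulation T (terminates E) R" and "R P Q"
  shows "rooted_dp_branching_bisimilar T (terminates E) (Prefix a P) (Prefix a Q)"
  using assms(1)
proof (rule rooted_dp_branching_bisimilarI)
  show "root_condition T (terminates E) R (Prefix a P) (Prefix a Q)"
    "root_condition T (terminates E) R (Prefix a Q) (Prefix a P)"
    using assms(2) dp_branching_bisimulation_sym[OF assms]
    by (auto simp: root_condition_def transition_Prefix)
qed

context
  fixes R :: "('l, 'c, 'd, 'n) proc \<Rightarrow> ('l, 'c, 'd, 'n) proc \<Rightarrow> bool"
  assumes R: "dp_branching_bisimulation T (terminates E) R"
begin

text \<open>A step discards the choice, so the residuals are already related by
  \<open>R\<close>.\<close>

lemma rooted_Alt:
  assumes "root_condition T (terminates E) R P1 Q1" "root_condition T (terminates E) R Q1 P1"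
    and "root_condition T (terminates E) R P2 Q2" "root_condition T (terminates E) R Q2 P2"
  shows "rooted_dp_branching_bisimilar T (terminates E) (Alt P1 P2) (Alt Q1 Q2)"
  using R
proof (rule rooted_dp_branching_bisimilarI)
  show "root_condition T (terminates E) R (Alt P1 P2) (Alt Q1 Q2)"
    "root_condition T (terminates E) R (Alt Q1 Q2) (Alt P1 P2)"
    using assms unfolding root_condition_def transition_Alt terminates_simps by blast+
qed

section \<open>Sequencing\<close>

text \<open>The case \<open>base\<close> covers residuals after control has passed to the second
  component. Before that, silent steps of \<open>B\<close> are blocked as long as the first
  component can move, so \<open>B\<close> must match termination and first steps of \<open>A\<close>
  directly; hence the root conditions.\<close>

inductive seq_rel :: "('l, 'c, 'd, 'n) proc \<Rightarrow> ('l, 'c, 'd, 'n) proc \<Rightarrow> bool" where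
  seq: "R p q \<Longrightarrow> root_condition T (terminates E) R A B \<Longrightarrow> root_condition T (terminates E) R B A \<Longrightarrow>
    seq_rel (Seq p A) (Seq q B)"
| base: "R p q \<Longrightarrow> seq_rel p q"

text \<open>Here \<open>p\<close> hands control to \<open>A\<close>. By
  \<open>stuck_terminating_match\<close>, \<open>q\<close> silently reaches a state that can hand
  over too, and the root condition lets \<open>B\<close> answer with a single step.\<close>

lemma seq_handover:
  assumes "R p q" "terminates E p" "\<nexists>b p'. T p b p'" and "root_condition T (terminates E) R A B"
    and "T A a A'"
  obtains q' B' where "(tau_step T)\<^sup>*\<^sup>* (Seq q B) (Seq q' B)" "T (Seq q' B) a B'" "R p q'" "R A' B'"
proof -
  obtain q' where q': "(tau_step T)\<^sup>*\<^sup>* q q'" "R p q'" "terminates E q'" "\<nexists>b r. T q' b r"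
    by (rule stuck_terminating_match[where trm = "terminates E", OF R assms(1,3,2)])
  obtain B' where B': "T B a B'" "R A' B'"
    using assms(4,5) unfolding root_condition_def by blast
  have "T (Seq q' B) a B'"
    unfolding transition_Seq using q'(3,4) B'(1) by blast
  then show ?thesis
    by (rule that[OF tau_steps_Seq[OF q'(1)] _ q'(2) B'(2)])
qed

lemma dp_branching_bisimulation_seq_rel: "dp_branching_bisimulation T (terminates E) seq_rel"
proof (rule dp_branching_bisimulationI)
  show "symp seq_rel"
    by (rule sympI) (auto elim!: seq_rel.cases intro: seq_rel.intros dp_branching_bisimulation_sym[OF R])
next
  fix s t a s' assume "seq_rel s t" and s': "T s a s'"
  then show "\<exists>t'' t'. (tau_step T)\<^sup>*\<^sup>* t t'' \<and> (T t'' a t' \<or> a = Tau \<and> t'' = t') \<and>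
      seq_rel s t'' \<and> seq_rel s' t'"
  proof cases
    case (seq p q A B)
    from s' consider p' where "T p a p'" "s' = Seq p' A"
      | "terminates E p" "T A a s'" "\<nexists>b p'. T p b p'"
      unfolding seq(1) transition_Seq by blast
    then show ?thesis
    proof cases
      case 1
      obtain q'' q' where q: "(tau_step T)\<^sup>*\<^sup>* q q''" "T q'' a q' \<or> a = Tau \<and> q'' = q'" "R p q''" "R p' q'"
        using dp_branching_bisimulation_step[OF R seq(3) 1(1)] .
      then have "T (Seq q'' B) a (Seq q' B) \<or> a = Tau \<and> Seq q'' B = Seq q' B"
        by (auto simp: transition_Seq)
      with q tau_steps_Seq[OF q(1)] show ?thesis
        unfolding seq(1,2) 1(2) using seq(4,5) by (blast intro: seq_rel.seq)
    next
      case 2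
      obtain q' B' where "(tau_step T)\<^sup>*\<^sup>* (Seq q B) (Seq q' B)" "T (Seq q' B) a B'" "R p q'" "R s' B'"
        using seq_handover[OF seq(3) 2(1,3) seq(4) 2(2)] .
      then show ?thesis
        unfolding seq(1,2) using seq(4,5) by (blast intro: seq_rel.intros)
    qed
  next
    case base
    from dp_branching_bisimulation_step[OF R base s'] show ?thesis
      by (metis seq_rel.base)
  qed
next
  fix s t assume "seq_rel s t" and "terminates E s"
  then show "\<exists>t'. (tau_step T)\<^sup>*\<^sup>* t t' \<and> terminates E t'"
  proof cases
    case (seq p q A B)
    with \<open>terminates E s\<close> have trm: "terminates E p" "terminates E A" by auto
    obtain q' where "(tau_step T)\<^sup>*\<^sup>* q q'" "terminates E q'"
      using dp_branching_bisimulation_trm[OF R seq(3) trm(1)] .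
    \<comment> \<open>\<open>root_condition\<close> transfers termination against the direction of
      steps, hence the condition from \<open>B\<close> to \<open>A\<close>.\<close>
    moreover have "terminates E B"
      using seq(5) trm(2) unfolding root_condition_def by blast
    ultimately show ?thesis
      unfolding seq(2) by (metis tau_steps_Seq terminates_simps(3))
  next
    case base
    from dp_branching_bisimulation_trm[OF R base \<open>terminates E s\<close>] show ?thesis by metis
  qed
next
  fix \<sigma> t
  assume path: "\<And>i. T (\<sigma> i) Tau (\<sigma> (Suc i))" and "\<And>i. seq_rel (\<sigma> i) t"
  then have "seq_rel (\<sigma> 0) t" by blast
  then show "\<exists>t' i. (tau_step T)\<^sup>+\<^sup>+ t t' \<and> seq_rel (\<sigma> i) t'"
  proof cases
    case base
    from dp_branching_bisimulation_divergence[OF R base path] show ?thesis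
      by (metis seq_rel.base)
  next
    case (seq p q A B)
    show ?thesis
    \<comment> \<open>Either the path hands control to \<open>A\<close> at some index, or it comes
      from an infinite silent path of the first component. Reachability of \<open>p'\<close> from
      \<open>p\<close> supplies a partner of \<open>p'\<close> reachable from
      \<open>q\<close>.\<close>
    proof (cases "\<exists>i p'. \<sigma> i = Seq p' A \<and> (tau_step T)\<^sup>*\<^sup>* p p' \<and> terminates E p' \<and>
        (\<nexists>b r. T p' b r) \<and> T A Tau (\<sigma> (Suc i))")
      case True
      then obtain i p' where p': "(tau_step T)\<^sup>*\<^sup>* p p'" "terminates E p'" "\<nexists>b r. T p' b r"
        and A: "T A Tau (\<sigma> (Suc i))" by blast
      obtain q1 where q1: "(tau_step T)\<^sup>*\<^sup>* q q1" "R p' q1"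
        using dp_branching_bisimulation_steps[OF R seq(3) p'(1)] .
      obtain q' B' where "(tau_step T)\<^sup>*\<^sup>* (Seq q1 B) (Seq q' B)" "T (Seq q' B) Tau B'" "R (\<sigma> (Suc i)) B'"
        using seq_handover[OF q1(2) p'(2,3) seq(4) A] by metis
      with tau_steps_Seq[OF q1(1)] have "(tau_step T)\<^sup>+\<^sup>+ (Seq q B) B'"
        by (metis rtranclp_trans rtranclp_into_tranclp1)
      with \<open>R (\<sigma> (Suc i)) B'\<close> show ?thesis
        unfolding seq(2) by (blast intro: seq_rel.base)
    next
      case False
      \<comment> \<open>Without handover every step is one of the first component. The reachability
        clause is what allows \<open>False\<close> to rule out a handover at each index.\<close>
      have "\<exists>\<pi>. \<forall>i. (\<sigma> i = Seq (\<pi> i) A \<and> (tau_step T)\<^sup>*\<^sup>* p (\<pi> i) \<and> (i = 0 \<longrightarrow> \<pi> i = p)) \<and>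
          T (\<pi> i) Tau (\<pi> (Suc i))"
      proof (rule dependent_nat_choice)
        show "\<exists>x. \<sigma> 0 = Seq x A \<and> (tau_step T)\<^sup>*\<^sup>* p x \<and> (0 = (0 :: nat) \<longrightarrow> x = p)"
          using seq(1) by blast
      next
        fix x and n :: nat
        assume x: "\<sigma> n = Seq x A \<and> (tau_step T)\<^sup>*\<^sup>* p x \<and> (n = 0 \<longrightarrow> x = p)"
        have "T (Seq x A) Tau (\<sigma> (Suc n))"
          using path[of n] x by simp
        with x False obtain y where "T x Tau y" "\<sigma> (Suc n) = Seq y A"
          unfolding transition_Seq by blast
        with x show "\<exists>y. (\<sigma> (Suc n) = Seq y A \<and> (tau_step T)\<^sup>*\<^sup>* p y \<and> (Suc n = 0 \<longrightarrow> y = p)) \<and> T x Tau y"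
          by (auto intro: rtranclp.rtrancl_into_rtrancl)
      qed
      then obtain \<pi> where \<pi>: "\<And>i. \<sigma> i = Seq (\<pi> i) A" "\<pi> 0 = p" "\<And>i. T (\<pi> i) Tau (\<pi> (Suc i))"
        by metis
      from seq(3) have "R (\<pi> 0) q" by (simp add: \<pi>(2))
      from dp_branching_bisimulation_divergence[OF R this \<pi>(3)]
      obtain q' i where "(tau_step T)\<^sup>+\<^sup>+ q q'" "R (\<pi> i) q'" .
      with \<pi>(1) show ?thesis
        unfolding seq(2) using seq(4,5) by (metis seq_rel.seq tau_stepsp_Seq)
    qed
  qed
qed

text \<open>Root-related \<open>P1\<close> and \<open>Q1\<close> have the same initial actions and
  terminate together, so one can hand over exactly when the other can, without preceding silent
  steps.\<close>

lemma root_condition_Seq: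
  assumes "root_condition T (terminates E) R P1 Q1" "root_condition T (terminates E) R Q1 P1"
    and "root_condition T (terminates E) R P2 Q2" "root_condition T (terminates E) R Q2 P2"
  shows "root_condition T (terminates E) seq_rel (Seq P1 P2) (Seq Q1 Q2)"
  unfolding root_condition_def
proof (intro conjI allI impI)
  fix a s assume "T (Seq P1 P2) a s"
  then consider P' where "T P1 a P'" "s = Seq P' P2"
    | "terminates E P1" "T P2 a s" "\<nexists>b P'. T P1 b P'"
    unfolding transition_Seq by blast
  then show "\<exists>t. T (Seq Q1 Q2) a t \<and> seq_rel s t"
  proof cases
    case 1
    with assms(1) obtain Q' where "T Q1 a Q'" "R P' Q'"
      unfolding root_condition_def by blast
    with 1(2) assms(3,4) show ?thesis
      unfolding transition_Seq by (blast intro: seq_rel.seq)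
  next
    case 2
    with assms have "terminates E Q1" "\<nexists>b Q'. T Q1 b Q'" "\<exists>t. T Q2 a t \<and> R s t"
      unfolding root_condition_def by blast+
    then show ?thesis
      unfolding transition_Seq by (blast intro: seq_rel.base)
  qed
next
  assume "terminates E (Seq Q1 Q2)"
  with assms show "terminates E (Seq P1 P2)"
    unfolding root_condition_def by simp
qed

lemma rooted_Seq:
  assumes "root_condition T (terminates E) R P1 Q1" "root_condition T (terminates E) R Q1 P1"
    and "root_condition T (terminates E) R P2 Q2" "root_condition T (terminates E) R Q2 P2"
  shows "rooted_dp_branching_bisimilar T (terminates E) (Seq P1 P2) (Seq Q1 Q2)"
  using dp_branching_bisimulation_seq_rel root_condition_Seq assms
  by (blast intro: rooted_dp_branching_bisimilarI)

section \<open>Parallel composition\<close>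

inductive par_rel :: "'c set \<Rightarrow> ('l, 'c, 'd, 'n) proc \<Rightarrow> ('l, 'c, 'd, 'n) proc \<Rightarrow> bool" for C where
  par: "R p p' \<Longrightarrow> R q q' \<Longrightarrow> par_rel C (Par C p q) (Par C p' q')"

text \<open>Visible actions cannot be matched by idling. Both partners first run their silent steps
  and then communicate, so the match contains a real step, which also settles divergences containing
  a communication.\<close>

lemma par_communication:
  assumes "R p p'" "R q q'" and "T p a p1" "T q b q1"
    and "a = Recv c d \<and> b = Send c d \<or> a = Send c d \<and> b = Recv c d" "c \<in> C"
  obtains p2 q2 p3 q3 where "(tau_step T)\<^sup>*\<^sup>* (Par C p' q') (Par C p2 q2)"
    "T (Par C p2 q2) Tau (Par C p3 q3)" "R p p2" "R q q2" "R p1 p3" "R q1 q3"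
proof -
  have "a \<noteq> Tau" "b \<noteq> Tau" using assms(5) by auto
  obtain p2 p3 where p: "(tau_step T)\<^sup>*\<^sup>* p' p2" "T p2 a p3" "R p p2" "R p1 p3"
    using dp_branching_bisimulation_step[OF R assms(1,3)] \<open>a \<noteq> Tau\<close> by metis
  obtain q2 q3 where q: "(tau_step T)\<^sup>*\<^sup>* q' q2" "T q2 b q3" "R q q2" "R q1 q3"
    using dp_branching_bisimulation_step[OF R assms(2,4)] \<open>b \<noteq> Tau\<close> by metis
  have "T (Par C p2 q2) Tau (Par C p3 q3)"
    using p(2) q(2) assms(5,6) unfolding transition_Par by blast
  with p q tau_steps_Par[OF p(1) q(1)] that show ?thesis by blast
qed

lemma transition_Par_cases:
  assumes "T (Par C p q) a x"
  obtains (left) p1 where "a \<notin> comm_actions C" "T p a p1" "x = Par C p1 q"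
  | (right) q1 where "a \<notin> comm_actions C" "T q a q1" "x = Par C p q1"
  | (comm) b b' c d p1 q1 where "a = Tau" "T p b p1" "T q b' q1"
      "b = Recv c d \<and> b' = Send c d \<or> b = Send c d \<and> b' = Recv c d" "c \<in> C" "x = Par C p1 q1"
  using assms unfolding transition_Par by blast

lemma dp_branching_bisimulation_par_rel: "dp_branching_bisimulation T (terminates E) (par_rel C)"
proof (rule dp_branching_bisimulationI)
  show "symp (par_rel C)"
    by (rule sympI) (auto elim!: par_rel.cases intro: par_rel.intros dp_branching_bisimulation_sym[OF R])
next
  fix s t a s' assume "par_rel C s t" and s': "T s a s'"
  then show "\<exists>t'' t'. (tau_step T)\<^sup>*\<^sup>* t t'' \<and> (T t'' a t' \<or> a = Tau \<and> t'' = t') \<and>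
      par_rel C s t'' \<and> par_rel C s' t'"
  proof cases
    case (par p p' q q')
    from s' have "T (Par C p q) a s'" by (simp add: par(1))
    then show ?thesis
    proof (cases rule: transition_Par_cases)
      case (left p1)
      obtain p2 p3 where p: "(tau_step T)\<^sup>*\<^sup>* p' p2" "T p2 a p3 \<or> a = Tau \<and> p2 = p3" "R p p2" "R p1 p3"
        using dp_branching_bisimulation_step[OF R par(3) left(2)] .
      then have "T (Par C p2 q') a (Par C p3 q') \<or> a = Tau \<and> Par C p2 q' = Par C p3 q'"
        using left(1) by (auto simp: transition_Par)
      with p tau_steps_Par[OF p(1) rtranclp.rtrancl_refl] show ?thesis
        unfolding par(1,2) left(3) using par(4) by (blast intro: par_rel.par)
    next
      case (right q1)
      obtain q2 q3 where q: "(tau_step T)\<^sup>*\<^sup>* q' q2" "T q2 a q3 \<or> a = Tau \<and> q2 = q3" "R q q2" "R q1 q3"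
        using dp_branching_bisimulation_step[OF R par(4) right(2)] .
      then have "T (Par C p' q2) a (Par C p' q3) \<or> a = Tau \<and> Par C p' q2 = Par C p' q3"
        using right(1) by (auto simp: transition_Par)
      with q tau_steps_Par[OF rtranclp.rtrancl_refl q(1)] show ?thesis
        unfolding par(1,2) right(3) using par(3) by (blast intro: par_rel.par)
    next
      case (comm b b' c d p1 q1)
      from par_communication[OF par(3,4) comm(2-5)] show ?thesis
        unfolding par(1,2) comm(1,6) by (metis par_rel.par)
    qed
  qed
next
  fix s t assume "par_rel C s t" and "terminates E s"
  then show "\<exists>t'. (tau_step T)\<^sup>*\<^sup>* t t' \<and> terminates E t'"
  proof cases
    case (par p p' q q')
    with \<open>terminates E s\<close> have trm: "terminates E p" "terminates E q" by auto
    obtain p1 where "(tau_step T)\<^sup>*\<^sup>* p' p1" "terminates E p1"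
      using dp_branching_bisimulation_trm[OF R par(3) trm(1)] .
    moreover obtain q1 where "(tau_step T)\<^sup>*\<^sup>* q' q1" "terminates E q1"
      using dp_branching_bisimulation_trm[OF R par(4) trm(2)] .
    ultimately show ?thesis
      unfolding par(2) by (metis tau_steps_Par terminates_simps(4))
  qed
next
  fix \<sigma> t
  assume path: "\<And>i. T (\<sigma> i) Tau (\<sigma> (Suc i))" and rel: "\<And>i. par_rel C (\<sigma> i) t"
  obtain p' q' where t: "t = Par C p' q'"
    using rel[of 0] by (auto elim: par_rel.cases)
  \<comment> \<open>The whole path is related to one \<open>t\<close>, so \<open>p'\<close> and
    \<open>q'\<close> serve for every index.\<close>
  have "\<exists>p q. \<sigma> i = Par C p q \<and> R p p' \<and> R q q'" for i
    using rel[of i] unfolding t by cases blast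
  then obtain f g where \<sigma>: "\<And>i. \<sigma> i = Par C (f i) (g i)"
    and f: "\<And>i. R (f i) p'" and g: "\<And>i. R (g i) q'"
    by metis
  show "\<exists>t' i. (tau_step T)\<^sup>+\<^sup>+ t t' \<and> par_rel C (\<sigma> i) t'"
  \<comment> \<open>If every step is a silent move of one component with the other unchanged, some
    component moves infinitely often. Otherwise a communication occurs.\<close>
  proof (cases "\<forall>i. T (f i) Tau (f (Suc i)) \<and> g (Suc i) = g i \<or>
      T (g i) Tau (g (Suc i)) \<and> f (Suc i) = f i")
    case True
    then have "{i. T (f i) Tau (f (Suc i))} \<union> {i. T (g i) Tau (g (Suc i))} = UNIV"
      by blast
    then have "infinite ({i. T (f i) Tau (f (Suc i))} \<union> {i. T (g i) Tau (g (Suc i))})"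
      by simp
    then consider "infinite {i. T (f i) Tau (f (Suc i))}" | "infinite {i. T (g i) Tau (g (Suc i))}"
      unfolding finite_Un by blast
    then show ?thesis
    proof cases
      case 1
      have "f (Suc i) = f i \<or> T (f i) Tau (f (Suc i))" for i
        using True by blast
      from dp_branching_bisimulation_stuttering_divergence[OF R f this 1]
      obtain p'' i where "(tau_step T)\<^sup>+\<^sup>+ p' p''" "R (f i) p''" .
      with g show ?thesis
        unfolding t \<sigma> by (blast intro: par_rel.par tau_stepsp_Par1)
    next
      case 2
      have "g (Suc i) = g i \<or> T (g i) Tau (g (Suc i))" for i
        using True by blast
      from dp_branching_bisimulation_stuttering_divergence[OF R g this 2]
      obtain q'' i where "(tau_step T)\<^sup>+\<^sup>+ q' q''" "R (g i) q''" .
      with f show ?thesis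
        unfolding t \<sigma> by (blast intro: par_rel.par tau_stepsp_Par2)
    qed
  next
    case False
    then obtain i where i: "\<not> (T (f i) Tau (f (Suc i)) \<and> g (Suc i) = g i)"
      "\<not> (T (g i) Tau (g (Suc i)) \<and> f (Suc i) = f i)" by blast
    have "T (Par C (f i) (g i)) Tau (Par C (f (Suc i)) (g (Suc i)))"
      using path[of i] by (simp add: \<sigma>)
    then show ?thesis
    proof (cases rule: transition_Par_cases)
      case (comm b b' c d p1 q1)
      then have eq: "p1 = f (Suc i)" "q1 = g (Suc i)" by auto
      obtain p2 q2 p3 q3 where "(tau_step T)\<^sup>*\<^sup>* (Par C p' q') (Par C p2 q2)"
        "T (Par C p2 q2) Tau (Par C p3 q3)" "R p1 p3" "R q1 q3"
        using par_communication[OF f[of i] g[of i] comm(2-5)] by metis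
      then show ?thesis
        unfolding t \<sigma> eq by (blast intro: par_rel.par rtranclp_into_tranclp1)
    qed (use i in auto)
  qed
qed

text \<open>The operand that does not move survives in the residual, so the root pairs themselves
  must lie in \<open>R\<close>.\<close>

lemma root_condition_Par:
  assumes "R P1 Q1" "R P2 Q2"
    and "root_condition T (terminates E) R P1 Q1" "root_condition T (terminates E) R P2 Q2"
  shows "root_condition T (terminates E) (par_rel C) (Par C P1 P2) (Par C Q1 Q2)"
  unfolding root_condition_def
proof (intro conjI allI impI)
  fix a s assume "T (Par C P1 P2) a s"
  then show "\<exists>t. T (Par C Q1 Q2) a t \<and> par_rel C s t"
  proof (cases rule: transition_Par_cases)
    case (left p1)
    with assms(3) obtain q1 where "T Q1 a q1" "R p1 q1"
      unfolding root_condition_def by blast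
    with left assms(2) show ?thesis
      unfolding transition_Par by (blast intro: par_rel.par)
  next
    case (right p2)
    with assms(4) obtain q2 where "T Q2 a q2" "R p2 q2"
      unfolding root_condition_def by blast
    with right assms(1) show ?thesis
      unfolding transition_Par by (blast intro: par_rel.par)
  next
    case (comm b b' c d p1 p2)
    with assms(3,4) obtain q1 q2 where "T Q1 b q1" "R p1 q1" "T Q2 b' q2" "R p2 q2"
      unfolding root_condition_def by blast
    with comm show ?thesis
      unfolding transition_Par by (blast intro: par_rel.par)
  qed
next
  assume "terminates E (Par C Q1 Q2)"
  with assms show "terminates E (Par C P1 P2)"
    unfolding root_condition_def by simp
qed

lemma rooted_Par:
  assumes "R P1 Q1" "R P2 Q2"
    and "root_condition T (terminates E) R P1 Q1" "root_condition T (terminates E) R Q1 P1"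
    and "root_condition T (terminates E) R P2 Q2" "root_condition T (terminates E) R Q2 P2"
  shows "rooted_dp_branching_bisimilar T (terminates E) (Par C P1 P2) (Par C Q1 Q2)"
  using dp_branching_bisimulation_par_rel
proof (rule rooted_dp_branching_bisimilarI)
  show "root_condition T (terminates E) (par_rel C) (Par C P1 P2) (Par C Q1 Q2)"
    using assms by (intro root_condition_Par)
  show "root_condition T (terminates E) (par_rel C) (Par C Q1 Q2) (Par C P1 P2)"
    using assms(1,2)[THEN dp_branching_bisimulation_sym[OF R]] assms(4,6)
    by (rule root_condition_Par)
qed

end

end

section \<open>Congruence from a common witness relation\<close>

theorem theorem1:
  fixes E :: "('l, 'c, 'd, 'n :: {countable, infinite}) spec"
    and T :: "('l, 'c, 'd, 'n) proc \<Rightarrow> ('l, 'c, 'd) action \<Rightarrow> ('l, 'c, 'd, 'n) proc \<Rightarrow> bool"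
    and P Q P1 P2 Q1 Q2 :: "('l, 'c, 'd, 'n) proc"
    and a :: "('l, 'c, 'd) action"
    and C' :: "'c set"
  assumes "recursive_spec E"
    and "transition_relation E T"
    and "rooted_dp_branching_bisimilar T (terminates E) P Q"
    and "rooted_dp_branching_bisimilar T (terminates E) P1 Q1"
    and "rooted_dp_branching_bisimilar T (terminates E) P2 Q2"
  shows "rooted_dp_branching_bisimilar T (terminates E) (Prefix a P) (Prefix a Q)
    \<and> rooted_dp_branching_bisimilar T (terminates E) (Alt P1 P2) (Alt Q1 Q2)
    \<and> rooted_dp_branching_bisimilar T (terminates E) (Seq P1 P2) (Seq Q1 Q2)
    \<and> rooted_dp_branching_bisimilar T (terminates E) (Par C' P1 P2) (Par C' Q1 Q2)"
proof -
  note T = assms(2)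
  obtain R0 where R0: "dp_branching_bisimulation T (terminates E) R0" "R0 P Q"
    using assms(3) by (rule rooted_dp_branching_bisimilarE)
  obtain R1 where R1: "dp_branching_bisimulation T (terminates E) R1" "R1 P1 Q1"
    "root_condition T (terminates E) R1 P1 Q1" "root_condition T (terminates E) R1 Q1 P1"
    using assms(4) by (rule rooted_dp_branching_bisimilarE)
  obtain R2 where R2: "dp_branching_bisimulation T (terminates E) R2" "R2 P2 Q2"
    "root_condition T (terminates E) R2 P2 Q2" "root_condition T (terminates E) R2 Q2 P2"
    using assms(5) by (rule rooted_dp_branching_bisimilarE)
  \<comment> \<open>The operands may come with different witnesses, while the operator lemmas work
    with a single relation; the union serves for both.\<close>
  let ?R = "sup R1 R2"
  have R: "dp_branching_bisimulation T (terminates E) ?R"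
    using R1(1) R2(1) by (rule dp_branching_bisimulation_sup)
  have rel: "?R P1 Q1" "?R P2 Q2"
    using R1(2) R2(2) by auto
  note root = R1(3,4)[THEN root_condition_mono, OF sup_ge1[of R1 R2]]
    R2(3,4)[THEN root_condition_mono, OF sup_ge2[of R2 R1]]
  show ?thesis
    using rooted_Prefix[OF T R0] rooted_Alt[OF T R root] rooted_Seq[OF T R root]
      rooted_Par[OF T R rel root] by blast
qed

end
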